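(* There exists a graph $G_{12}$ on $12$ vertices such that the inertial partition of $G_{12}$ and the Hermitian inertial partition of $G_{12}$ are both equal to the partition $(3,3,2)$.
   Context: All graphs are finite, simple and undirected. For a graph $G=(V,E)$ with vertex set $V=\{1,\ldots,n\}$, $\mathcal{S}(G)$ (respectively $\mathcal{H}(G)$) is the set of all real symmetric (respectively complex Hermitian) $n\times n$ matrices $A=[a_{ij}]$ such that for $i\neq j$, $a_{ij}\neq 0$ if and only if $ij\in E$ (no condition on the diagonal entries). The partial inertia of a Hermitian matrix $A$ is $\operatorname{pin}(A)=(\pi(A),\nu(A))$, where $\pi(A)$ and $\nu(A)$ are the numbers of positive and of negative eigenvalues of $A$, counted with multiplicity. Define $\mathcal{I}(G)=\{\operatorname{pin}(A): A\in\mathcal{S}(G)\}$ and $\mathrm{h}\mathcal{I}(G)=\{\operatorname{pin}(A): A\in\mathcal{H}(G)\}$. For $j\in\{0,\ldots,n\}$ let $\pi_j(G)=\min\{r:(r,j)\in\mathcal{I}(G)\}$ and $\mathrm{h}\pi_j(G)=\min\{r:(r,j)\in\mathrm{h}\mathcal{I}(G)\}$. With $m=\pi_0(G)$ and $h=\mathrm{h}\pi_0(G)$, the inertial partition of $G$ is the sequence $(\pi_0(G),\pi_1(G),\ldots,\pi_{m-1}(G))$ and the Hermitian inertial partition of $G$ is the sequence $(\mathrm{h}\pi_0(G),\mathrm{h}\pi_1(G),\ldots,\mathrm{h}\pi_{h-1}(G))$. *)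

theory Defs
  imports
    "Jordan_Normal_Form.Schur_Decomposition"
    "Graph_Theory.Pair_Digraph"
begin

text \<open>
  A finite simple undirected graph is a \<^locale>\<open>pair_graph\<close>: a finite, loop-free pair digraph with a
  symmetric arc relation, where an edge \<open>ij\<close> is the pair of arcs \<open>(i, j)\<close> and \<open>(j, i)\<close>.
  Since matrix indices start at \<open>0\<close>, the vertex set of a graph on \<open>n\<close> vertices
  is \<open>{0..<n}\<close> instead of \<open>{1..n}\<close>; the definitions below are meant for such graphs.
\<close>

definition has_pattern :: "nat pair_pre_digraph \<Rightarrow> 'a::zero mat \<Rightarrow> bool" where
  "has_pattern G A \<longleftrightarrow>
     A \<in> carrier_mat (card (pverts G)) (card (pverts G)) \<and>
     (\<forall>i\<in>pverts G. \<forall>j\<in>pverts G. i \<noteq> j \<longrightarrow> (A $$ (i, j) \<noteq> 0 \<longleftrightarrow> (i, j) \<in> parcs G))"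

definition sym_mats :: "nat pair_pre_digraph \<Rightarrow> real mat set" where
  "sym_mats G = {A. has_pattern G A \<and> transpose_mat A = A}"

definition herm_mats :: "nat pair_pre_digraph \<Rightarrow> complex mat set" where
  "herm_mats G = {A. has_pattern G A \<and> mat_adjoint A = A}"

text \<open>
  The eigenvalues of a Hermitian matrix are real, so it suffices to range over real \<open>x\<close>.
\<close>

definition num_pos_eigenvalues :: "complex mat \<Rightarrow> nat" where
  "num_pos_eigenvalues A =
     (\<Sum>x | 0 < x \<and> eigenvalue A (complex_of_real x). order (complex_of_real x) (char_poly A))"

definition num_neg_eigenvalues :: "complex mat \<Rightarrow> nat" where
  "num_neg_eigenvalues A =
     (\<Sum>x | x < 0 \<and> eigenvalue A (complex_of_real x). order (complex_of_real x) (char_poly A))"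

definition pin :: "complex mat \<Rightarrow> nat \<times> nat" where
  "pin A = (num_pos_eigenvalues A, num_neg_eigenvalues A)"

definition inertia_set :: "nat pair_pre_digraph \<Rightarrow> (nat \<times> nat) set" where
  "inertia_set G = {pin (map_mat complex_of_real A) | A. A \<in> sym_mats G}"

definition herm_inertia_set :: "nat pair_pre_digraph \<Rightarrow> (nat \<times> nat) set" where
  "herm_inertia_set G = {pin A | A. A \<in> herm_mats G}"

text \<open>
  For \<open>j \<le> n\<close> both minima exist, since \<open>(n - j, j)\<close> is the partial inertia of a matrix with
  \<open>n - j\<close> diagonal entries \<open>1\<close>, \<open>j\<close> diagonal entries \<open>- 1\<close> and small off-diagonal entries.
\<close>

definition min_pos :: "nat pair_pre_digraph \<Rightarrow> nat \<Rightarrow> nat" where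
  "min_pos G j = (LEAST r. (r, j) \<in> inertia_set G)"

definition herm_min_pos :: "nat pair_pre_digraph \<Rightarrow> nat \<Rightarrow> nat" where
  "herm_min_pos G j = (LEAST r. (r, j) \<in> herm_inertia_set G)"

definition inertial_partition :: "nat pair_pre_digraph \<Rightarrow> nat list" where
  "inertial_partition G = map (min_pos G) [0..<min_pos G 0]"

definition herm_inertial_partition :: "nat pair_pre_digraph \<Rightarrow> nat list" where
  "herm_inertial_partition G = map (herm_min_pos G) [0..<herm_min_pos G 0]"

end

theory Submission
  imports Defs
begin

text \<open>
  The graph is the non-orthogonality graph of twelve vectors of \<open>\<int>\<^sup>3\<close>: the three unit vectors,
  the six vectors \<open>(0, 1, \<plusminus>1)\<close>, \<open>(1, 0, \<plusminus>1)\<close>, \<open>(1, \<plusminus>1, 0)\<close>, and \<open>(1, 1, 1)\<close>, \<open>(-1, 1, 1)\<close>,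
  \<open>(1, -1, 1)\<close>.  Their Gram matrix has partial inertia \<open>(3, 0)\<close>.  The point of the choice is that
  these orthogonality relations force definiteness: a Hermitian matrix of rank at most \<open>3\<close> with
  this zero pattern is a Gram matrix of twelve vectors in a complex space of dimension \<open>3\<close> with a
  Hermitian form, and that form cannot have signature \<open>(2, 1)\<close> or a degeneration of it.

  To see this (lemma \<open>no_form_signature_2_1\<close>), let \<open>a\<close> be the matrix.  The vectors \<open>0, 1, 2\<close> are
  pairwise orthogonal, and the relations to the vectors \<open>3, 4, 5\<close> prevent any two of them from being
  parallel; a linear dependence would have to involve all three and make them isotropic.  In
  signature \<open>(2, 1)\<close> two orthogonal vectors of nonpositive norm are parallel, and three
  independent orthogonal vectors cannot all have nonnegative norm.  Hence exactly one of the
  three norms \<open>N 0, N 1, N 2\<close> is negative and the other two are positive.  In particular the three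
  vectors are an orthogonal basis, and \<open>a v w\<close> is the sum of \<open>a v i * cnj (a w i) / N i\<close> over
  \<open>i < 3\<close>.  Choose the scale of the basis vectors so that vector \<open>9\<close> has coordinates
  \<open>(1, 1, 1)\<close>; the weights become \<open>\<alpha>, \<beta>, \<gamma>\<close>, with the signs of \<open>N 0, N 1, N 2\<close>.  Orthogonality to
  vector \<open>9\<close> and within the pairs forces vectors \<open>3, 4, 5\<close> to be \<open>(0, 1, 1)\<close>, \<open>(1, 0, 1)\<close>, \<open>(1, 1, 0)\<close>
  up to scaling.  Vector \<open>10\<close> has equal second and third coordinates, because it shares with
  vector \<open>9\<close> the orthogonality to vector \<open>6\<close>, and it is orthogonal to vectors \<open>4\<close> and \<open>5\<close>; this
  gives \<open>\<beta> = \<gamma>\<close>.  Vector \<open>11\<close> gives \<open>\<alpha> = \<gamma>\<close> in the same way.  So the three norms have the same sign,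
  a contradiction.

  Replacing a matrix by its negative excludes signature \<open>(1, 2)\<close> as well, so no pair \<open>(r, s)\<close> with
  \<open>r \<le> 2\<close>, \<open>s \<le> 1\<close> or \<open>r \<le> 1\<close>, \<open>s \<le> 2\<close> occurs, even for Hermitian matrices.  Therefore it suffices
  to write down real matrices with the pattern that are a sum of \<open>p\<close> positive and \<open>q\<close> negative
  rank-one terms for \<open>(p, q) = (3, 0), (3, 1), (2, 2)\<close>: by Sylvester's law (lemma
  \<open>num_eigenvalues_le\<close>) their partial inertia is at most \<open>(p, q)\<close> componentwise, and the exclusion,
  together with a negative diagonal entry in the case of \<open>(3, 1)\<close>, makes it equal to \<open>(p, q)\<close>.

  The link between eigenvalues and sums of rank-one terms is the spectral theorem
  (lemma \<open>hermitian_diagonal_form\<close>).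
\<close>

section \<open>Homogeneous linear systems\<close>

text \<open>
  Gaussian elimination, one equation and one unknown at a time.  The index types are arbitrary, so
  that equations of different origin can be combined by a disjoint sum.
\<close>

lemma homogeneous_system_nontrivial:
  fixes m :: "'k \<Rightarrow> 'i \<Rightarrow> 'a::field"
  assumes "finite T" "finite S" "card T < card S"
  shows "\<exists>c. (\<exists>i\<in>S. c i \<noteq> 0) \<and> (\<forall>k\<in>T. (\<Sum>i\<in>S. c i * m k i) = 0)"
  using assms
proof (induction T arbitrary: S m rule: finite_induct)
  case empty
  then have "S \<noteq> {}" by auto
  then show ?case by (intro exI[of _ "\<lambda>_. 1"]) auto
next
  case (insert t T)
  show ?case
  proof (cases "\<forall>i\<in>S. m t i = 0")
    case True
    have "card T < card S" using insert by simp
    from insert.IH[OF insert.prems(1) this, of m] True show ?thesis by auto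
  next
    case False
    then obtain j where j: "j \<in> S" "m t j \<noteq> 0" by blast
    define S' where "S' = S - {j}"
    have S': "finite S'" "card T < card S'" "j \<notin> S'" "S = insert j S'"
      using insert j by (auto simp: S'_def)
    \<comment> \<open>the system that results when the unknown \<open>j\<close> is eliminated with the equation \<open>t\<close>\<close>
    define m' where "m' = (\<lambda>k i. m k i - m k j * m t i / m t j)"
    obtain c where c: "\<exists>i\<in>S'. c i \<noteq> 0" "\<forall>k\<in>T. (\<Sum>i\<in>S'. c i * m' k i) = 0"
      using insert.IH[OF S'(1,2), of m'] by blast
    define c' where "c' = c(j := - (\<Sum>i\<in>S'. c i * m t i) / m t j)"
    have sum': "(\<Sum>i\<in>S. c' i * m k i) = (\<Sum>i\<in>S'. c i * m' k i)" for k
    proof -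
      have "(\<Sum>i\<in>S. c' i * m k i) = c' j * m k j + (\<Sum>i\<in>S'. c' i * m k i)"
        using S' by simp
      also have "(\<Sum>i\<in>S'. c' i * m k i) = (\<Sum>i\<in>S'. c i * m k i)"
        using S' by (intro sum.cong) (auto simp: c'_def)
      also have "c' j * m k j = - (\<Sum>i\<in>S'. c i * (m k j * m t i / m t j))"
        by (simp add: c'_def sum_distrib_left sum_divide_distrib sum_distrib_right mult_ac)
      finally show ?thesis by (simp add: m'_def algebra_simps sum_subtractf)
    qed
    have "(\<Sum>i\<in>S. c' i * m t i) = 0"
      using j(2) by (simp add: sum' m'_def)
    then have "\<forall>k\<in>insert t T. (\<Sum>i\<in>S. c' i * m k i) = 0"
      using c(2) by (simp add: sum')
    moreover have "\<exists>i\<in>S. c' i \<noteq> 0" using c(1) S' by (auto simp: c'_def)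
    ultimately show ?thesis by blast
  qed
qed

section \<open>Unitary diagonalization\<close>

lemma mat_adjoint_index:
  assumes "A \<in> carrier_mat n n" "i < n" "j < n"
  shows "mat_adjoint (A :: complex mat) $$ (i, j) = cnj (A $$ (j, i))"
  using assms by (simp add: mat_adjoint_def mat_of_rows_def)

lemma cscalar_prod_eq_sum:
  fixes x y :: "complex vec"
  assumes "x \<in> carrier_vec n" "y \<in> carrier_vec n"
  shows "x \<bullet>c y = (\<Sum>i<n. x $ i * cnj (y $ i))"
  using assms by (auto simp: scalar_prod_def atLeast0LessThan intro!: sum.cong)

lemma mult_mat_vec_index_sum:
  assumes "A \<in> carrier_mat n n" "x \<in> carrier_vec n" "i < n"
  shows "(A *\<^sub>v x) $ i = (\<Sum>j<n. A $$ (i, j) * x $ j)"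
  using assms by (auto simp: scalar_prod_def atLeast0LessThan intro!: sum.cong)

lemma mult_mat_vec_cscalar_prod:
  fixes P :: "complex mat"
  assumes "P \<in> carrier_mat n n" "c \<in> carrier_vec n" "y \<in> carrier_vec n"
  shows "(P *\<^sub>v c) \<bullet>c y = (\<Sum>i<n. c $ i * (col P i \<bullet>c y))"
proof -
  have "(P *\<^sub>v c) \<bullet>c y = (\<Sum>r<n. \<Sum>i<n. P $$ (r, i) * c $ i * cnj (y $ r))"
    using assms by (subst cscalar_prod_eq_sum[of _ n])
      (auto simp: mult_mat_vec_index_sum[of _ n] sum_distrib_right simp del: index_mult_mat_vec)
  also have "\<dots> = (\<Sum>i<n. c $ i * (col P i \<bullet>c y))"
    using assms by (subst sum.swap, intro sum.cong refl, subst cscalar_prod_eq_sum[of _ n])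
      (auto simp: sum_distrib_left mult_ac)
  finally show ?thesis .
qed

lemma cscalar_prod_commute:
  fixes x y :: "complex vec"
  assumes "x \<in> carrier_vec n" "y \<in> carrier_vec n"
  shows "x \<bullet>c y = cnj (y \<bullet>c x)"
  using assms by (simp add: cscalar_prod_eq_sum[of _ n] mult.commute)

lemma cscalar_prod_mult_mat_vec:
  fixes P :: "complex mat"
  assumes "P \<in> carrier_mat n n" "c \<in> carrier_vec n" "y \<in> carrier_vec n"
  shows "y \<bullet>c (P *\<^sub>v c) = (\<Sum>i<n. cnj (c $ i) * (y \<bullet>c col P i))"
proof -
  have "y \<bullet>c (P *\<^sub>v c) = cnj ((P *\<^sub>v c) \<bullet>c y)"
    using assms by (intro cscalar_prod_commute[of _ n]) auto
  also have "\<dots> = (\<Sum>i<n. cnj (c $ i) * cnj (col P i \<bullet>c y))"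
    using assms by (simp add: mult_mat_vec_cscalar_prod)
  also have "\<dots> = (\<Sum>i<n. cnj (c $ i) * (y \<bullet>c col P i))"
    using assms by (intro sum.cong refl arg_cong2[of _ _ _ _ times] cscalar_prod_commute[of _ n, symmetric]) auto
  finally show ?thesis .
qed

lemma hermitian_cscalar_prod:
  fixes A :: "complex mat"
  assumes "A \<in> carrier_mat n n" "mat_adjoint A = A" "x \<in> carrier_vec n" "y \<in> carrier_vec n"
  shows "(A *\<^sub>v x) \<bullet>c y = x \<bullet>c (A *\<^sub>v y)"
proof -
  have herm: "cnj (A $$ (i, j)) = A $$ (j, i)" if "i < n" "j < n" for i j
    using mat_adjoint_index[OF assms(1) that(2,1)] assms(2) by simp
  have "(A *\<^sub>v x) \<bullet>c y = (\<Sum>i<n. \<Sum>j<n. A $$ (i, j) * x $ j * cnj (y $ i))"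
    using assms by (subst cscalar_prod_eq_sum[of _ n])
      (auto simp: mult_mat_vec_index_sum[of _ n] sum_distrib_right simp del: index_mult_mat_vec)
  also have "\<dots> = (\<Sum>j<n. \<Sum>i<n. A $$ (i, j) * x $ j * cnj (y $ i))"
    by (rule sum.swap)
  also have "\<dots> = x \<bullet>c (A *\<^sub>v y)"
    using assms by (subst cscalar_prod_eq_sum[of _ n])
      (auto simp: mult_mat_vec_index_sum[of _ n] sum_distrib_left herm mult_ac simp del: index_mult_mat_vec
        intro!: sum.cong)
  finally show ?thesis .
qed

text \<open>
  Schur's theorem gives \<open>A = P * B * Q\<close> with \<open>Q\<close> inverse to \<open>P\<close> and \<open>B\<close> upper triangular, which means
  that the spans \<open>S k\<close> of the first \<open>k\<close> columns of \<open>P\<close> are invariant under \<open>A\<close>.  Let \<open>u k\<close> be a nonzero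
  vector of \<open>S (k + 1)\<close> orthogonal to \<open>S k\<close>.  Modulo \<open>S k\<close>, the map \<open>A\<close> acts on \<open>S (k + 1)\<close> as
  multiplication by \<open>B $$ (k, k)\<close>, so \<open>w = A *\<^sub>v u k - B $$ (k, k) \<cdot>\<^sub>v u k\<close> lies in \<open>S k\<close>; but \<open>w\<close> is also
  orthogonal to \<open>S k\<close>, since \<open>A\<close> is Hermitian and preserves \<open>S k\<close>.  Hence \<open>w = 0\<close>.
\<close>

lemma hermitian_orthogonal_eigenvectors:
  fixes A :: "complex mat"
  assumes A: "A \<in> carrier_mat n n" and herm: "mat_adjoint A = A"
  shows "\<exists>d u. char_poly A = (\<Prod>k<n. [:- d k, 1:]) \<and>
    (\<forall>k<n. u k \<in> carrier_vec n \<and> u k \<noteq> 0\<^sub>v n \<and> A *\<^sub>v u k = d k \<cdot>\<^sub>v u k) \<and>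
    (\<forall>j<n. \<forall>k<n. j \<noteq> k \<longrightarrow> u j \<bullet>c u k = 0)"
proof -
  from char_poly_factorized[OF A]
  obtain es where "char_poly A = (\<Prod>e\<leftarrow>es. [:- e, 1:])" by blast
  with schur_decomposition[OF A this] obtain B P Q where
    sim: "similar_mat_wit A B P Q" and upper: "upper_triangular B"
    by (cases "schur_decomposition A es") blast
  from similar_mat_witD2[OF A sim]
  have PQ: "P * Q = 1\<^sub>m n" and QP: "Q * P = 1\<^sub>m n" and APBQ: "A = P * B * Q"
    and B: "B \<in> carrier_mat n n" and P: "P \<in> carrier_mat n n" and Q: "Q \<in> carrier_mat n n"
    by auto
  have AP: "A * P = P * B"
    using A B P Q by (simp add: APBQ QP assoc_mult_mat[of _ n n _ n _ n])
  have A_P: "A *\<^sub>v (P *\<^sub>v c) = P *\<^sub>v (B *\<^sub>v c)" if "c \<in> carrier_vec n" for c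
    using assoc_mult_mat_vec[OF A P that] assoc_mult_mat_vec[OF P B that] by (simp add: AP)
  have B0: "B $$ (i, j) = 0" if "j < i" "i < n" for i j
    using upper B that by auto
  define d where "d k = B $$ (k, k)" for k
  have cp: "char_poly A = (\<Prod>k<n. [:- d k, 1:])"
  proof -
    have "char_poly A = char_poly B"
      using sim by (intro char_poly_similar) (auto simp: similar_mat_def)
    also have "\<dots> = (\<Prod>a\<leftarrow>diag_mat B. [:- a, 1:])"
      by (rule char_poly_upper_triangular[OF B upper])
    also have "\<dots> = (\<Prod>k<n. [:- d k, 1:])"
      using B prod.distinct_set_conv_list[of "[0..<n]" "\<lambda>k. [:- d k, 1:]"]
      by (simp add: diag_mat_def d_def o_def atLeast0LessThan)
    finally show ?thesis .
  qed
  \<comment> \<open>\<open>k\<close> orthogonality conditions on \<open>k + 1\<close> coefficients\<close>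
  have "\<exists>c. c \<in> carrier_vec n \<and> c \<noteq> 0\<^sub>v n \<and> (\<forall>i<n. k < i \<longrightarrow> c $ i = 0) \<and>
      (\<forall>j<k. (P *\<^sub>v c) \<bullet>c col P j = 0)" if k: "k < n" for k
  proof -
    obtain c where c: "\<exists>i\<in>{..k}. c i \<noteq> 0"
      "\<And>j. j < k \<Longrightarrow> (\<Sum>i\<le>k. c i * (col P i \<bullet>c col P j)) = 0"
      using homogeneous_system_nontrivial[of "{..<k}" "{..k}" "\<lambda>j i. col P i \<bullet>c col P j"] by auto
    define x where "x = vec n (\<lambda>i. if i \<le> k then c i else 0)"
    have x: "x \<in> carrier_vec n" by (simp add: x_def)
    from c(1) obtain i where "i \<le> k" "c i \<noteq> 0" by blast
    then have "x $ i \<noteq> 0" using k by (simp add: x_def)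
    then have "x \<noteq> 0\<^sub>v n" using k \<open>i \<le> k\<close> by auto
    moreover have "(P *\<^sub>v x) \<bullet>c col P j = 0" if "j < k" for j
    proof -
      have "(P *\<^sub>v x) \<bullet>c col P j = (\<Sum>i<n. x $ i * (col P i \<bullet>c col P j))"
        using P x k that by (intro mult_mat_vec_cscalar_prod) auto
      also have "\<dots> = (\<Sum>i\<le>k. c i * (col P i \<bullet>c col P j))"
        using k by (intro sum.mono_neutral_cong_right) (auto simp: x_def)
      finally show ?thesis using c(2)[OF that] by simp
    qed
    ultimately show ?thesis using x by (intro exI[of _ x]) (auto simp: x_def)
  qed
  then obtain c where c: "\<And>k. k < n \<Longrightarrow> c k \<in> carrier_vec n" "\<And>k. k < n \<Longrightarrow> c k \<noteq> 0\<^sub>v n"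
    "\<And>i k. k < n \<Longrightarrow> i < n \<Longrightarrow> k < i \<Longrightarrow> c k $ i = 0"
    "\<And>j k. k < n \<Longrightarrow> j < k \<Longrightarrow> (P *\<^sub>v c k) \<bullet>c col P j = 0"
    by metis
  define u where "u k = P *\<^sub>v c k" for k
  have u: "u k \<in> carrier_vec n" if "k < n" for k
    using that P c(1) by (simp add: u_def)
  have flag_orth: "u k \<bullet>c (P *\<^sub>v x) = 0"
    if "k < n" "x \<in> carrier_vec n" "\<And>i. i < n \<Longrightarrow> k \<le> i \<Longrightarrow> x $ i = 0" for k x
  proof -
    have "u k \<bullet>c (P *\<^sub>v x) = (\<Sum>i<n. cnj (x $ i) * (u k \<bullet>c col P i))"
      using that P u by (intro cscalar_prod_mult_mat_vec) auto
    also have "\<dots> = 0"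
      using that c(4) by (intro sum.neutral ballI) (metis complex_cnj_zero lessThan_iff mult_eq_0_iff not_le u_def)
    finally show ?thesis .
  qed
  have u0: "u k \<noteq> 0\<^sub>v n" if "k < n" for k
  proof
    assume "u k = 0\<^sub>v n"
    then have "Q *\<^sub>v (P *\<^sub>v c k) = 0\<^sub>v n"
      using Q by (intro eq_vecI) (auto simp: u_def)
    then have "c k = 0\<^sub>v n"
      using assoc_mult_mat_vec[OF Q P c(1)[OF that]] c(1)[OF that] by (simp add: QP)
    with c(2)[OF that] show False by simp
  qed
  have less_orth: "u k \<bullet>c u j = 0" if "j < k" "k < n" for j k
    using flag_orth[of k "c j"] c that by (auto simp: u_def)
  have orth: "u j \<bullet>c u k = 0" if "j < n" "k < n" "j \<noteq> k" for j k
    using less_orth[of j k] less_orth[of k j] cscalar_prod_commute[OF u u, of j k] that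
    by (cases "j < k") auto
  have eig: "A *\<^sub>v u k = d k \<cdot>\<^sub>v u k" if k: "k < n" for k
  proof -
    define x where "x = B *\<^sub>v c k - d k \<cdot>\<^sub>v c k"
    have x: "x \<in> carrier_vec n" using B c(1)[OF k] by (simp add: x_def)
    have Bv: "(B *\<^sub>v v) $ i = 0"
      if "v \<in> carrier_vec n" "\<And>j. j < n \<Longrightarrow> l \<le> j \<Longrightarrow> v $ j = 0" "i < n" "l \<le> i" for v l i
    proof -
      have "(B *\<^sub>v v) $ i = (\<Sum>j<n. B $$ (i, j) * v $ j)"
        using B that by (intro mult_mat_vec_index_sum)
      also have "\<dots> = 0"
        using that B0 by (intro sum.neutral ballI) (metis lessThan_iff mult_eq_0_iff le_less_trans not_le)
      finally show ?thesis .
    qed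
    have x0: "x $ i = 0" if i: "i < n" "k \<le> i" for i
    proof (cases "i = k")
      case True
      have "(B *\<^sub>v c k) $ k = (\<Sum>j<n. B $$ (k, j) * c k $ j)"
        using B c(1) k by (intro mult_mat_vec_index_sum) auto
      also have "\<dots> = (\<Sum>j\<in>{k}. B $$ (k, j) * c k $ j)"
        using k c(3)[OF k] B0[of _ k] 
        by (intro sum.mono_neutral_right) (auto, metis linorder_neqE_nat)
      finally show ?thesis using True B k c(1)[OF k] by (simp add: x_def d_def)
    next
      case False
      then have "(B *\<^sub>v c k) $ i = 0"
        using Bv[of "c k" "Suc k" i] c(1,3)[OF k] i by auto
      then show ?thesis using False B k i c(1)[OF k] c(3)[OF k i(1)] by (simp add: x_def)
    qed
    define w where "w = P *\<^sub>v x"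
    have w: "w \<in> carrier_vec n" using P x by (simp add: w_def)
    have w_eq: "w = A *\<^sub>v u k - d k \<cdot>\<^sub>v u k"
      using P B c(1)[OF k]
      by (simp add: w_def x_def u_def A_P mult_minus_distrib_mat_vec[of _ n n] mult_mat_vec[of _ n n])
    have "w \<bullet>c w = (A *\<^sub>v u k) \<bullet>c w - d k * (u k \<bullet>c w)"
      using A u[OF k] w by (subst (1) w_eq) (simp add: minus_scalar_prod_distrib[of _ n])
    also have "(A *\<^sub>v u k) \<bullet>c w = u k \<bullet>c (A *\<^sub>v w)"
      using A herm u[OF k] w by (intro hermitian_cscalar_prod)
    also have "A *\<^sub>v w = P *\<^sub>v (B *\<^sub>v x)" using x by (simp add: w_def A_P)
    also have "u k \<bullet>c (P *\<^sub>v (B *\<^sub>v x)) = 0"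
      using Bv[OF x] x0 B k x by (intro flag_orth) auto
    also have "u k \<bullet>c w = 0"
      unfolding w_def using x x0 k by (intro flag_orth) auto
    finally have "w = 0\<^sub>v n" using w by (simp add: conjugate_square_eq_0_vec[of _ n])
    then have e: "A *\<^sub>v u k - d k \<cdot>\<^sub>v u k = 0\<^sub>v n" by (simp add: w_eq)
    show ?thesis
    proof (rule eq_vecI)
      fix i assume "i < dim_vec (d k \<cdot>\<^sub>v u k)"
      then have i: "i < n" using u[OF k] by simp
      have "(A *\<^sub>v u k - d k \<cdot>\<^sub>v u k) $ i = 0" using i by (simp add: e)
      then show "(A *\<^sub>v u k) $ i = (d k \<cdot>\<^sub>v u k) $ i"
        using i A u[OF k] by (simp del: index_mult_mat_vec)
    qed (use A u[OF k] in auto)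
  qed
  show ?thesis using cp u u0 eig orth by blast
qed


section \<open>Diagonal forms and Sylvester's law of inertia\<close>

text \<open>
  The weights are arbitrary reals and the vectors \<open>u k\<close> need not be independent, so the definition
  covers both the spectral decomposition and an explicit sum of rank-one terms.
\<close>

definition diagonal_form ::
  "nat \<Rightarrow> (nat \<Rightarrow> nat \<Rightarrow> complex) \<Rightarrow> 'k set \<Rightarrow> ('k \<Rightarrow> real) \<Rightarrow> ('k \<Rightarrow> nat \<Rightarrow> complex) \<Rightarrow> bool" where
  "diagonal_form n a K e u \<longleftrightarrow> finite K \<and>
     (\<forall>i<n. \<forall>j<n. a i j = (\<Sum>k\<in>K. of_real (e k) * u k i * cnj (u k j)))"

lemma diagonal_form_uminus:
  "diagonal_form n a K e u \<Longrightarrow> diagonal_form n (\<lambda>i j. - a i j) K (\<lambda>k. - e k) u"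
  by (simp add: diagonal_form_def sum_negf)

lemma diagonal_form_row:
  assumes "diagonal_form n a K e u" "S \<subseteq> {..<n}" "j < n"
  shows "(\<Sum>i\<in>S. x i * a i j) = (\<Sum>k\<in>K. of_real (e k) * (\<Sum>i\<in>S. x i * u k i) * cnj (u k j))"
proof -
  have "(\<Sum>i\<in>S. x i * a i j) = (\<Sum>i\<in>S. \<Sum>k\<in>K. of_real (e k) * (x i * u k i) * cnj (u k j))"
  proof (intro sum.cong refl)
    fix i assume "i \<in> S"
    with assms have "a i j = (\<Sum>k\<in>K. of_real (e k) * u k i * cnj (u k j))"
      by (auto simp: diagonal_form_def)
    then show "x i * a i j = (\<Sum>k\<in>K. of_real (e k) * (x i * u k i) * cnj (u k j))"
      by (simp add: sum_distrib_left mult_ac)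
  qed
  also have "\<dots> = (\<Sum>k\<in>K. \<Sum>i\<in>S. of_real (e k) * (x i * u k i) * cnj (u k j))"
    by (rule sum.swap)
  finally show ?thesis by (simp add: sum_distrib_left sum_distrib_right)
qed

text \<open>
  The restriction to an index set \<open>S\<close> makes this the value of the form on vectors supported in \<open>S\<close>.
\<close>

lemma diagonal_form_quadratic:
  assumes "diagonal_form n a K e u" "S \<subseteq> {..<n}"
  shows "(\<Sum>j\<in>S. (\<Sum>i\<in>S. x i * a i j) * cnj (x j)) =
    of_real (\<Sum>k\<in>K. e k * (cmod (\<Sum>i\<in>S. x i * u k i))\<^sup>2)"
proof -
  define l where "l k = (\<Sum>i\<in>S. x i * u k i)" for k
  have "(\<Sum>j\<in>S. (\<Sum>i\<in>S. x i * a i j) * cnj (x j)) =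
      (\<Sum>j\<in>S. (\<Sum>k\<in>K. of_real (e k) * l k * cnj (u k j)) * cnj (x j))"
    using assms by (intro sum.cong refl arg_cong2[of _ _ _ _ times])
      (auto simp: l_def diagonal_form_row[OF assms])
  also have "\<dots> = (\<Sum>j\<in>S. \<Sum>k\<in>K. of_real (e k) * l k * cnj (x j * u k j))"
    by (simp add: sum_distrib_right sum_distrib_left mult_ac)
  also have "\<dots> = (\<Sum>k\<in>K. \<Sum>j\<in>S. of_real (e k) * l k * cnj (x j * u k j))"
    by (rule sum.swap)
  also have "\<dots> = (\<Sum>k\<in>K. of_real (e k) * (l k * cnj (l k)))"
    by (simp add: sum_distrib_left l_def mult_ac)
  also have "\<dots> = of_real (\<Sum>k\<in>K. e k * (cmod (l k))\<^sup>2)"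
    by (simp only: of_real_sum of_real_mult complex_norm_square)
  finally show ?thesis by (simp add: l_def)
qed

lemma dependent_rows_rank:
  assumes a: "diagonal_form n a K e u" and S: "S \<subseteq> {..<n}"
    and card: "card {k\<in>K. e k \<noteq> 0} < card S"
  shows "\<exists>c. (\<exists>i\<in>S. c i \<noteq> 0) \<and> (\<forall>j<n. (\<Sum>i\<in>S. c i * a i j) = 0)"
proof -
  have "finite {k\<in>K. e k \<noteq> 0}" "finite S"
    using a S by (auto simp: diagonal_form_def intro: finite_subset)
  from homogeneous_system_nontrivial[OF this card, of u] obtain c
    where c: "\<exists>i\<in>S. c i \<noteq> 0" "\<And>k. k \<in> K \<Longrightarrow> e k \<noteq> 0 \<Longrightarrow> (\<Sum>i\<in>S. c i * u k i) = 0"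
    by auto
  have "(\<Sum>i\<in>S. c i * a i j) = 0" if "j < n" for j
    unfolding diagonal_form_row[OF a S that] using c(2) by (intro sum.neutral) auto
  with c(1) show ?thesis by blast
qed

text \<open>
  The next lemma and its mirror image \<open>dependent_rows_nonpos\<close> are the geometric facts about
  indefinite forms: a space of positive index \<open>p\<close> has no more than \<open>p\<close> pairwise
  orthogonal vectors of nonnegative norm that are independent modulo the radical.  With more of them than positive weights, some
  combination \<open>c\<close> is annihilated by all coordinates of positive weight.  The form is then at most
  \<open>0\<close> on \<open>c\<close>, while orthogonality makes it at least \<open>0\<close>; so all coordinates of nonzero weight
  vanish on \<open>c\<close>, which therefore lies in the radical.
\<close>

lemma dependent_rows_nonneg:
  assumes a: "diagonal_form n a K e u" and S: "S \<subseteq> {..<n}"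
    and orth: "\<And>i j. i \<in> S \<Longrightarrow> j \<in> S \<Longrightarrow> i \<noteq> j \<Longrightarrow> a i j = 0"
    and nonneg: "\<And>i. i \<in> S \<Longrightarrow> 0 \<le> Re (a i i)"
    and card: "card {k\<in>K. 0 < e k} < card S"
  shows "\<exists>c. (\<exists>i\<in>S. c i \<noteq> 0) \<and> (\<forall>j<n. (\<Sum>i\<in>S. c i * a i j) = 0)"
proof -
  have K: "finite K" and fS: "finite S"
    using a S by (auto simp: diagonal_form_def intro: finite_subset)
  then have "finite {k\<in>K. 0 < e k}" by simp
  from homogeneous_system_nontrivial[OF this fS card, of u] obtain c
    where c: "\<exists>i\<in>S. c i \<noteq> 0" "\<And>k. k \<in> K \<Longrightarrow> 0 < e k \<Longrightarrow> (\<Sum>i\<in>S. c i * u k i) = 0"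
    by auto
  define f where "f k = e k * (cmod (\<Sum>i\<in>S. c i * u k i))\<^sup>2" for k
  have "(\<Sum>j\<in>S. (\<Sum>i\<in>S. c i * a i j) * cnj (c j)) = (\<Sum>j\<in>S. c j * a j j * cnj (c j))"
  proof (intro sum.cong refl arg_cong2[of _ _ _ _ times])
    fix j assume j: "j \<in> S"
    have "(\<Sum>i\<in>S. c i * a i j) = (\<Sum>i\<in>{j}. c i * a i j)"
      using j orth fS by (intro sum.mono_neutral_right) auto
    then show "(\<Sum>i\<in>S. c i * a i j) = c j * a j j" by simp
  qed
  also have "Re \<dots> = (\<Sum>j\<in>S. (cmod (c j))\<^sup>2 * Re (a j j))"
  proof -
    have "Re (z * w * cnj z) = (cmod z)\<^sup>2 * Re w" for z w :: complex
    proof -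
      have eq: "z * w * cnj z = of_real ((cmod z)\<^sup>2) * w"
        unfolding complex_norm_square by (simp add: mult_ac)
      show ?thesis unfolding eq by simp
    qed
    then show ?thesis by simp
  qed
  finally have "(\<Sum>k\<in>K. f k) = (\<Sum>j\<in>S. (cmod (c j))\<^sup>2 * Re (a j j))"
    by (simp add: diagonal_form_quadratic[OF a S] f_def)
  also have "\<dots> \<ge> 0" using nonneg by (intro sum_nonneg) auto
  finally have "(\<Sum>k\<in>K. - f k) \<le> 0" by (simp add: sum_negf)
  moreover have f_nonpos: "0 \<le> - f k" if "k \<in> K" for k
    using c(2)[OF that] by (cases "0 < e k") (auto simp: f_def mult_nonpos_nonneg)
  ultimately have "\<And>k. k \<in> K \<Longrightarrow> f k = 0"
    using K sum_nonneg[OF f_nonpos, of K] sum_nonneg_eq_0_iff[OF K f_nonpos] by force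
  then have l: "e k = 0 \<or> (\<Sum>i\<in>S. c i * u k i) = 0" if "k \<in> K" for k
    using that by (auto simp: f_def)
  have "(\<Sum>i\<in>S. c i * a i j) = 0" if "j < n" for j
    unfolding diagonal_form_row[OF a S that] using l by (intro sum.neutral) auto
  with c(1) show ?thesis by blast
qed

lemma dependent_rows_nonpos:
  assumes a: "diagonal_form n a K e u" and S: "S \<subseteq> {..<n}"
    and orth: "\<And>i j. i \<in> S \<Longrightarrow> j \<in> S \<Longrightarrow> i \<noteq> j \<Longrightarrow> a i j = 0"
    and nonpos: "\<And>i. i \<in> S \<Longrightarrow> Re (a i i) \<le> 0"
    and card: "card {k\<in>K. e k < 0} < card S"
  shows "\<exists>c. (\<exists>i\<in>S. c i \<noteq> 0) \<and> (\<forall>j<n. (\<Sum>i\<in>S. c i * a i j) = 0)"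
  using dependent_rows_nonneg[OF diagonal_form_uminus[OF a] S] orth nonpos card
  by (simp add: sum_negf)

text \<open>
  If the basis form had more positive weights than the other one, the linear conditions \<open>T\<close> below
  (the coordinates of nonpositive weight in the first form and of positive weight in the second
  one vanish) would be fewer than \<open>n\<close>.  On a nonzero solution the first form is at least \<open>0\<close> and
  the second at most \<open>0\<close>, so all coordinates in the first form vanish.
\<close>

lemma sylvester_card_pos_le:
  assumes a: "diagonal_form n a K e u" and a': "diagonal_form n a K' e' u'"
    and card: "card K \<le> n"
    and inj: "\<And>x. (\<And>k. k \<in> K \<Longrightarrow> (\<Sum>i<n. x i * u k i) = 0) \<Longrightarrow> \<forall>i<n. x i = 0"
  shows "card {k\<in>K. 0 < e k} \<le> card {k\<in>K'. 0 < e' k}"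
proof (rule ccontr)
  assume less: "\<not> ?thesis"
  have K: "finite K" "finite K'" using a a' by (auto simp: diagonal_form_def)
  define T where "T = {k\<in>K. \<not> 0 < e k} <+> {k\<in>K'. 0 < e' k}"
  have "card {k\<in>K. 0 < e k} + card {k\<in>K. \<not> 0 < e k} = card K"
    using K card_Un_disjoint[of "{k\<in>K. 0 < e k}" "{k\<in>K. \<not> 0 < e k}"]
    by (simp add: disjoint_iff Collect_disj_eq[symmetric] conj_disj_distribL[symmetric])
  moreover have "card T = card {k\<in>K. \<not> 0 < e k} + card {k\<in>K'. 0 < e' k}"
    unfolding T_def using K by (intro card_Plus) auto
  ultimately have "card T < card {..<n}" using less card by simp
  moreover have "finite T" using K by (simp add: T_def)
  ultimately obtain x where x: "\<exists>i\<in>{..<n}. x i \<noteq> 0"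
    "\<forall>t\<in>T. (\<Sum>i<n. x i * case_sum u u' t i) = 0"
    using homogeneous_system_nontrivial[of T "{..<n}" "case_sum u u'"] by auto
  have xu: "(\<Sum>i<n. x i * u k i) = 0" if "k \<in> K" "\<not> 0 < e k" for k
    using bspec[OF x(2), of "Inl k"] that by (auto simp: T_def)
  have xu': "(\<Sum>i<n. x i * u' k i) = 0" if "k \<in> K'" "0 < e' k" for k
    using bspec[OF x(2), of "Inr k"] that by (auto simp: T_def)
  define f where "f k = e k * (cmod (\<Sum>i<n. x i * u k i))\<^sup>2" for k
  have "(\<Sum>k\<in>K. f k) = (\<Sum>k\<in>K'. e' k * (cmod (\<Sum>i<n. x i * u' k i))\<^sup>2)"
    using trans[OF diagonal_form_quadratic[OF a order_refl, of x, symmetric]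
        diagonal_form_quadratic[OF a' order_refl, of x]]
    unfolding f_def of_real_eq_iff .
  also have "\<dots> \<le> 0"
  proof (intro sum_nonpos)
    fix k assume "k \<in> K'"
    with xu'[of k] show "e' k * (cmod (\<Sum>i<n. x i * u' k i))\<^sup>2 \<le> 0"
      by (cases "0 < e' k") (auto simp: mult_nonpos_nonneg)
  qed
  finally have f_le: "(\<Sum>k\<in>K. f k) \<le> 0" .
  have f_nonneg: "0 \<le> f k" if "k \<in> K" for k
    using xu[OF that] by (cases "0 < e k") (auto simp: f_def)
  have f0: "f k = 0" if "k \<in> K" for k
    using f_le sum_nonneg[OF f_nonneg, of K] sum_nonneg_eq_0_iff[OF K(1) f_nonneg] that by force
  have "(\<Sum>i<n. x i * u k i) = 0" if "k \<in> K" for k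
    using f0[OF that] xu[OF that] by (cases "0 < e k") (auto simp: f_def)
  from inj[OF this] x(1) show False by auto
qed

section \<open>Inertia of a Hermitian matrix\<close>

lemma order_prod_linear_factors:
  fixes d :: "'k \<Rightarrow> 'a::idom"
  assumes "finite K"
  shows "order x (\<Prod>k\<in>K. [:- d k, 1:]) = card {k\<in>K. d k = x}"
  using assms
proof (induction K rule: finite_induct)
  case empty
  then show ?case by simp
next
  case (insert k K)
  have "order x [:- d k, 1:] = (if d k = x then 1 else 0)"
  proof (cases "d k = x")
    case True
    then show ?thesis using order_power_n_n[of x 1] by simp
  next
    case False
    then have "poly [:- d k, 1:] x \<noteq> 0" by simp
    then show ?thesis using False order_root[of "[:- d k, 1:]" x] by simp
  qed
  moreover have "order x (\<Prod>k\<in>insert k K. [:- d k, 1:]) =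
      order x [:- d k, 1:] + order x (\<Prod>k\<in>K. [:- d k, 1:])"
    unfolding prod.insert[OF insert.hyps]
    by (rule order_mult, unfold mult_eq_0_iff prod_zero_iff[OF insert.hyps(1)]) simp
  ultimately have "order x (\<Prod>k\<in>insert k K. [:- d k, 1:]) =
      (if d k = x then 1 else 0) + card {k\<in>K. d k = x}"
    using insert.IH by simp
  also have "\<dots> = card {k'\<in>insert k K. d k' = x}"
  proof (cases "d k = x")
    case True
    then have "{k'\<in>insert k K. d k' = x} = insert k {k'\<in>K. d k' = x}" by auto
    then show ?thesis using insert.hyps True by simp
  next
    case False
    then have "{k'\<in>insert k K. d k' = x} = {k'\<in>K. d k' = x}" by auto
    then show ?thesis using False by simp
  qed
  finally show ?case .
qed

text \<open>
  Both eigenvalue counts have this shape, with \<open>R\<close> the predicate of being positive or negative.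
\<close>

lemma sum_order_char_poly:
  fixes A :: "complex mat"
  assumes A: "A \<in> carrier_mat n n"
    and cp: "char_poly A = (\<Prod>k<n. [:- complex_of_real (r k), 1:])"
  shows "(\<Sum>x | R x \<and> eigenvalue A (complex_of_real x). order (complex_of_real x) (char_poly A)) =
    card {k. k < n \<and> R (r k)}"
proof -
  have eig: "eigenvalue A (complex_of_real x) \<longleftrightarrow> (\<exists>k<n. r k = x)" for x
    unfolding eigenvalue_root_char_poly[OF A] cp by (auto simp: poly_prod)
  have ord: "order (complex_of_real x) (char_poly A) = card {k. k < n \<and> r k = x}" for x
    unfolding cp by (subst order_prod_linear_factors) auto
  have "card {k. k < n \<and> R (r k)} =
      (\<Sum>x\<in>r ` {k. k < n \<and> R (r k)}. card {k. k \<in> {k. k < n \<and> R (r k)} \<and> r k = x})"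
    by (simp only: card_eq_sum, intro sum.image_gen) simp
  also have "\<dots> = (\<Sum>x\<in>r ` {k. k < n \<and> R (r k)}. card {k. k < n \<and> r k = x})"
    by (intro sum.cong refl arg_cong[of _ _ card]) auto
  also have "\<dots> = (\<Sum>x | R x \<and> eigenvalue A (complex_of_real x). order (complex_of_real x) (char_poly A))"
    unfolding ord by (intro sum.cong) (auto simp: eig)
  finally show ?thesis ..
qed

text \<open>
  The spectral theorem.  The eigenvectors are not normalized; the weight \<open>e k\<close> is the eigenvalue
  divided by the squared length of the eigenvector, which has the same sign.  The second property
  says that the \<open>u k\<close> span the whole space.
\<close>

lemma hermitian_diagonal_form:
  fixes A :: "complex mat"
  assumes A: "A \<in> carrier_mat n n" and herm: "mat_adjoint A = A"
  obtains e :: "nat \<Rightarrow> real" and u :: "nat \<Rightarrow> nat \<Rightarrow> complex"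
  where "diagonal_form n (\<lambda>i j. A $$ (i, j)) {..<n} e u"
    and "\<forall>x. (\<forall>k<n. (\<Sum>i<n. x i * u k i) = 0) \<longrightarrow> (\<forall>i<n. x i = 0)"
    and "num_pos_eigenvalues A = card {k\<in>{..<n}. 0 < e k}"
    and "num_neg_eigenvalues A = card {k\<in>{..<n}. e k < 0}"
proof -
  obtain d v where cp: "char_poly A = (\<Prod>k<n. [:- d k, 1:])"
    and v: "\<And>k. k < n \<Longrightarrow> v k \<in> carrier_vec n" and v0: "\<And>k. k < n \<Longrightarrow> v k \<noteq> 0\<^sub>v n"
    and eig: "\<And>k. k < n \<Longrightarrow> A *\<^sub>v v k = d k \<cdot>\<^sub>v v k"
    and orth: "\<And>j k. j < n \<Longrightarrow> k < n \<Longrightarrow> j \<noteq> k \<Longrightarrow> v j \<bullet>c v k = 0"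
    using hermitian_orthogonal_eigenvectors[OF A herm] by blast
  define s where "s k = (\<Sum>i<n. (cmod (v k $ i))\<^sup>2)" for k
  have vv: "v k \<bullet>c v k = of_real (s k)" if "k < n" for k
    using v[OF that] by (simp add: cscalar_prod_eq_sum[of _ n] s_def flip: complex_norm_square)
  have s_pos: "0 < s k" if "k < n" for k
  proof -
    have "s k \<noteq> 0" using vv[OF that] v[OF that] v0[OF that] conjugate_square_eq_0_vec[OF v[OF that]] by auto
    moreover have "0 \<le> s k" by (simp add: s_def sum_nonneg)
    ultimately show ?thesis by simp
  qed
  have d_real: "d k = of_real (Re (d k))" if k: "k < n" for k
  proof -
    have "(A *\<^sub>v v k) \<bullet>c v k = v k \<bullet>c (A *\<^sub>v v k)"
      by (rule hermitian_cscalar_prod[OF A herm v[OF k] v[OF k]])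
    then have "d k * of_real (s k) = cnj (d k) * of_real (s k)"
      using v[OF k] vv[OF k] by (simp add: eig[OF k] conjugate_smult_vec)
    then have "d k = cnj (d k)" using s_pos[OF k] by simp
    then show ?thesis by (simp add: complex_eq_iff)
  qed
  define U where "U = mat n n (\<lambda>(i, k). v k $ i)"
  define M where "M = mat n n (\<lambda>(k, i). cnj (v k $ i) / of_real (s k))"
  have UM: "U \<in> carrier_mat n n" "M \<in> carrier_mat n n" by (simp_all add: U_def M_def)
  have "M * U = 1\<^sub>m n"
  proof (rule eq_matI)
    fix j k assume "j < dim_row (1\<^sub>m n)" "k < dim_col (1\<^sub>m n)"
    then have jk: "j < n" "k < n" by auto
    have "(M * U) $$ (j, k) = (\<Sum>i<n. cnj (v j $ i) / of_real (s j) * v k $ i)"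
      using jk by (simp add: U_def M_def scalar_prod_def atLeast0LessThan)
    also have "\<dots> = (v k \<bullet>c v j) / of_real (s j)"
      using v jk by (simp add: cscalar_prod_eq_sum[of _ n] sum_divide_distrib mult_ac)
    also have "\<dots> = 1\<^sub>m n $$ (j, k)"
      using jk orth[of k j] vv[of j] s_pos[of j] by auto
    finally show "(M * U) $$ (j, k) = 1\<^sub>m n $$ (j, k)" .
  qed (auto simp: U_def M_def)
  then have "U * M = 1\<^sub>m n"
    using mat_mult_left_right_inverse[OF UM(2,1)] by simp
  then have complete: "(\<Sum>k<n. v k $ i * cnj (v k $ j) / of_real (s k)) = (if i = j then 1 else 0)"
    if "i < n" "j < n" for i j
  proof -
    have "(U * M) $$ (i, j) = (\<Sum>k<n. v k $ i * cnj (v k $ j) / of_real (s k))"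
      using that by (simp add: U_def M_def scalar_prod_def atLeast0LessThan)
    then show ?thesis using \<open>U * M = 1\<^sub>m n\<close> that by simp
  qed
  define e where "e k = Re (d k) / s k" for k
  define u where "u k i = v k $ i" for k i
  \<comment> \<open>expansion of a vector in the orthogonal basis of eigenvectors\<close>
  have resolve: "y j = (\<Sum>k<n. (\<Sum>i<n. y i * v k $ i) * (cnj (v k $ j) / of_real (s k)))"
    if "j < n" for y :: "nat \<Rightarrow> complex" and j
  proof -
    have "y j = (\<Sum>i<n. y i * (if i = j then 1 else 0))"
      using that by (simp add: sum.delta if_distrib cong: if_cong)
    also have "\<dots> = (\<Sum>i<n. \<Sum>k<n. y i * v k $ i * (cnj (v k $ j) / of_real (s k)))"
    proof (intro sum.cong refl)
      fix i assume "i \<in> {..<n}"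
      then have "(if i = j then 1 else 0) = (\<Sum>k<n. v k $ i * cnj (v k $ j) / of_real (s k))"
        using complete that by simp
      then show "y i * (if i = j then 1 else 0) =
          (\<Sum>k<n. y i * v k $ i * (cnj (v k $ j) / of_real (s k)))"
        by (simp only: sum_distrib_left times_divide_eq_right mult.assoc)
    qed
    also have "\<dots> = (\<Sum>k<n. \<Sum>i<n. y i * v k $ i * (cnj (v k $ j) / of_real (s k)))"
      by (rule sum.swap)
    finally show ?thesis by (simp only: sum_distrib_right)
  qed
  show ?thesis
  proof
    show "diagonal_form n (\<lambda>i j. A $$ (i, j)) {..<n} e u"
      unfolding diagonal_form_def
    proof (intro conjI allI impI)
      fix i j assume ij: "i < n" "j < n"
      have "A $$ (i, j) = (\<Sum>k<n. (A *\<^sub>v v k) $ i * (cnj (v k $ j) / of_real (s k)))"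
        unfolding resolve[OF ij(2), of "\<lambda>l. A $$ (i, l)"]
        using ij v by (intro sum.cong refl) (simp only: mult_mat_vec_index_sum[OF A] lessThan_iff)
      also have "\<dots> = (\<Sum>k<n. of_real (e k) * u k i * cnj (u k j))"
      proof (intro sum.cong refl)
        fix k assume "k \<in> {..<n}"
        then have k: "k < n" by simp
        have "(A *\<^sub>v v k) $ i = of_real (Re (d k)) * v k $ i"
          using v[OF k] ij by (simp add: eig[OF k] flip: d_real[OF k])
        then show "(A *\<^sub>v v k) $ i * (cnj (v k $ j) / of_real (s k)) = of_real (e k) * u k i * cnj (u k j)"
          by (simp add: e_def u_def)
      qed
      finally show "A $$ (i, j) = (\<Sum>k<n. of_real (e k) * u k i * cnj (u k j))" .
    qed simp
    show "\<forall>x. (\<forall>k<n. (\<Sum>i<n. x i * u k i) = 0) \<longrightarrow> (\<forall>i<n. x i = 0)"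
    proof (intro allI impI)
      fix x j assume 0: "\<forall>k<n. (\<Sum>i<n. x i * u k i) = 0" and j: "j < n"
      show "x j = 0"
        unfolding resolve[OF j, of x] using 0 by (intro sum.neutral) (simp add: u_def)
    qed
    have e_sign: "0 < e k \<longleftrightarrow> 0 < Re (d k)" "e k < 0 \<longleftrightarrow> Re (d k) < 0" if "k < n" for k
      using s_pos[OF that] by (simp_all add: e_def zero_less_divide_iff divide_less_0_iff)
    have cp': "char_poly A = (\<Prod>k<n. [:- complex_of_real (Re (d k)), 1:])"
      unfolding cp using d_real by (intro prod.cong) auto
    show "num_pos_eigenvalues A = card {k\<in>{..<n}. 0 < e k}"
      unfolding num_pos_eigenvalues_def sum_order_char_poly[OF A cp']
      using e_sign by (intro arg_cong[of _ _ card]) auto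
    show "num_neg_eigenvalues A = card {k\<in>{..<n}. e k < 0}"
      unfolding num_neg_eigenvalues_def sum_order_char_poly[OF A cp']
      using e_sign by (intro arg_cong[of _ _ card]) auto
  qed
qed

lemma num_eigenvalues_le:
  fixes A :: "complex mat"
  assumes A: "A \<in> carrier_mat n n" and herm: "mat_adjoint A = A"
    and form: "diagonal_form n (\<lambda>i j. A $$ (i, j)) K e u"
  shows "num_pos_eigenvalues A \<le> card {k\<in>K. 0 < e k}"
    and "num_neg_eigenvalues A \<le> card {k\<in>K. e k < 0}"
proof -
  obtain e' u' where form': "diagonal_form n (\<lambda>i j. A $$ (i, j)) {..<n} e' u'"
    and inj: "\<forall>x. (\<forall>k<n. (\<Sum>i<n. x i * u' k i) = 0) \<longrightarrow> (\<forall>i<n. x i = 0)"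
    and pos: "num_pos_eigenvalues A = card {k\<in>{..<n}. 0 < e' k}"
    and neg: "num_neg_eigenvalues A = card {k\<in>{..<n}. e' k < 0}"
    by (rule hermitian_diagonal_form[OF A herm]) (rule that)
  show "num_pos_eigenvalues A \<le> card {k\<in>K. 0 < e k}"
    unfolding pos
  proof (rule sylvester_card_pos_le[OF form' form])
    show "\<forall>i<n. x i = 0" if "\<And>k. k \<in> {..<n} \<Longrightarrow> (\<Sum>i<n. x i * u' k i) = 0" for x
      using inj[rule_format, of x] that by blast
  qed simp
  have "card {k\<in>{..<n}. 0 < - e' k} \<le> card {k\<in>K. 0 < - e k}"
  proof (rule sylvester_card_pos_le[OF diagonal_form_uminus[OF form'] diagonal_form_uminus[OF form]])
    show "\<forall>i<n. x i = 0" if "\<And>k. k \<in> {..<n} \<Longrightarrow> (\<Sum>i<n. x i * u' k i) = 0" for x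
      using inj[rule_format, of x] that by blast
  qed simp
  then show "num_neg_eigenvalues A \<le> card {k\<in>K. e k < 0}"
    unfolding neg by simp
qed


lemma num_neg_eigenvalues_pos:
  fixes A :: "complex mat"
  assumes A: "A \<in> carrier_mat n n" and herm: "mat_adjoint A = A"
    and i: "i < n" "Re (A $$ (i, i)) < 0"
  shows "0 < num_neg_eigenvalues A"
proof (rule ccontr)
  assume "\<not> ?thesis"
  moreover obtain e u where form: "diagonal_form n (\<lambda>i j. A $$ (i, j)) {..<n} e u"
    and "num_neg_eigenvalues A = card {k\<in>{..<n}. e k < 0}"
    by (rule hermitian_diagonal_form[OF A herm]) (rule that)
  ultimately have nonneg: "0 \<le> e k" if "k < n" for k
    using that by (auto simp: not_less dest!: spec[of _ k])
  have "A $$ (i, i) = (\<Sum>k<n. of_real (e k) * (u k i * cnj (u k i)))"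
    using form i by (simp add: diagonal_form_def mult.assoc)
  also have "\<dots> = of_real (\<Sum>k<n. e k * (cmod (u k i))\<^sup>2)"
    by (simp only: of_real_sum of_real_mult complex_norm_square)
  finally have "Re (A $$ (i, i)) = (\<Sum>k<n. e k * (cmod (u k i))\<^sup>2)"
    by simp
  also have "\<dots> \<ge> 0" using nonneg by (intro sum_nonneg) auto
  finally show False using i by simp
qed

section \<open>The graph\<close>

text \<open>
  Up to scaling, these are the thirteen rays of Yu and Oh without \<open>(1, 1, -1)\<close>.  For \<open>i < 3\<close>, the
  rays \<open>i\<close>, \<open>3 + i\<close>, \<open>6 + i\<close> form an orthogonal basis; rays \<open>9, 10, 11\<close> have no zero coordinate.
\<close>

definition rays :: "int list list" where
  "rays = [[1, 0, 0], [0, 1, 0], [0, 0, 1],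
     [0, 1, 1], [1, 0, 1], [1, 1, 0],
     [0, 1, -1], [1, 0, -1], [1, -1, 0],
     [1, 1, 1], [-1, 1, 1], [1, -1, 1]]"

definition ray_prod :: "nat \<Rightarrow> nat \<Rightarrow> int" where
  "ray_prod i j = (\<Sum>k<3. rays ! i ! k * rays ! j ! k)"

definition G12 :: "nat pair_pre_digraph" where
  "G12 = \<lparr>pverts = {0..<12},
     parcs = {(i, j). i < 12 \<and> j < 12 \<and> i \<noteq> j \<and> ray_prod i j \<noteq> 0}\<rparr>"

lemma sum_less_3: "(\<Sum>k<3. f k) = f 0 + f 1 + f (2::nat)"
  by (simp add: eval_nat_numeral)

lemma sum_less_4: "(\<Sum>k<4. f k) = f 0 + f 1 + f 2 + f (3::nat)"
  by (simp add: eval_nat_numeral)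

lemma all_less_3: "(\<forall>i<3. P i) \<longleftrightarrow> P 0 \<and> P 1 \<and> P (2::nat)"
  by (simp add: eval_nat_numeral All_less_Suc conj_ac)

lemma all_less_12: "(\<forall>i<12. P i) \<longleftrightarrow>
    P 0 \<and> P 1 \<and> P 2 \<and> P 3 \<and> P 4 \<and> P 5 \<and> P 6 \<and> P 7 \<and> P 8 \<and> P 9 \<and> P 10 \<and> P (11::nat)"
  by (simp add: eval_nat_numeral All_less_Suc conj_ac)

lemma ray_prod_commute: "ray_prod i j = ray_prod j i"
  by (simp add: ray_prod_def mult.commute)

lemma pair_graph_G12: "pair_graph G12"
proof
  show "finite (pverts G12)" by (simp add: G12_def)
  have "parcs G12 \<subseteq> {0..<12} \<times> {0..<12}" by (auto simp: G12_def)
  then show "finite (parcs G12)" by (rule finite_subset) simp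
  show "symmetric (with_proj G12)"
    by (auto simp: symmetric_def G12_def with_proj_def arcs_ends_def arc_to_ends_def ray_prod_commute intro!: symI)
qed (auto simp: G12_def)

section \<open>The pattern admits no form of signature (2,1)\<close>

text \<open>
  The following three lemmas are about vectors whose coordinates of one index are zero or can be
  split off, so that only two coordinates, with weights \<open>p\<close> and \<open>q\<close>, remain.
\<close>

lemma orthogonal_to_same_imp_parallel:
  fixes p q x x' y y' z z' :: complex
  assumes "p * z * cnj x + q * z' * cnj x' = 0" "p * z * cnj y + q * z' * cnj y' = 0"
    and "p \<noteq> 0" "z \<noteq> 0" "q \<noteq> 0" "z' \<noteq> 0"
  shows "x * y' = y * x'"
proof -
  have "(p * z) * (cnj x * cnj y' - cnj y * cnj x') =
      (p * z * cnj x + q * z' * cnj x') * cnj y' - (p * z * cnj y + q * z' * cnj y') * cnj x'"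
    by (simp add: algebra_simps)
  then have "cnj (x * y') = cnj (y * x')" using assms by simp
  then show ?thesis by (simp only: complex_cnj_cancel_iff)
qed

text \<open>
  Here \<open>z\<close> and \<open>y\<close> are the partners \<open>6 + i\<close> and \<open>3 + i\<close>.  Both \<open>y\<close> and the two coordinates of \<open>r\<close> are
  orthogonal to \<open>z\<close>, so they are parallel, and orthogonality of \<open>y\<close> to \<open>s\<close> passes on to \<open>r\<close>.
\<close>

lemma orthogonal_to_partner:
  fixes p q r r' s s' y y' z z' :: complex
  assumes "p * z * cnj y + q * z' * cnj y' = 0" "p * z * cnj r + q * z' * cnj r' = 0"
    and "p * y * cnj s + q * y' * cnj s' = 0"
    and "p \<noteq> 0" "z \<noteq> 0" "q \<noteq> 0" "z' \<noteq> 0" "y' \<noteq> 0"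
  shows "p * r * cnj s + q * r' * cnj s' = 0"
proof -
  have par: "y * r' = r * y'"
    using orthogonal_to_same_imp_parallel[of p z y q z' y' r r'] assms by simp
  have "y' * (p * r * cnj s + q * r' * cnj s') = p * (r * y') * cnj s + q * y' * r' * cnj s'"
    by (simp add: algebra_simps)
  also have "\<dots> = r' * (p * y * cnj s + q * y' * cnj s')"
    by (simp add: algebra_simps flip: par)
  finally show ?thesis using assms by simp
qed

text \<open>
  Here \<open>r\<close> is ray \<open>9\<close> and \<open>s\<close> is ray \<open>10\<close> or \<open>11\<close>.  The vector \<open>z\<close> is orthogonal to both, so \<open>s\<close> is a
  multiple of \<open>r\<close> in the two coordinates at hand.  The term \<open>w\<close> is the contribution of the third
  coordinate; eliminating it gives \<open>p * r * cnj s = q * r' * cnj s'\<close>.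
\<close>

lemma weighted_norms_eq:
  fixes p q :: real and r r' s s' z z' w :: complex
  assumes "p * z * cnj r + q * z' * cnj r' = 0" "p * z * cnj s + q * z' * cnj s' = 0"
    and "w + p * r * cnj s = 0" "w + q * r' * cnj s' = 0"
    and "p \<noteq> 0" "z \<noteq> 0" "q \<noteq> 0" "z' \<noteq> 0" "s \<noteq> 0"
  shows "p * (cmod r)\<^sup>2 = q * (cmod r')\<^sup>2"
proof -
  have "r * s' = s * r'"
    using orthogonal_to_same_imp_parallel[of p z r q z' r' s s'] assms by simp
  then have par: "cnj r * cnj s' = cnj s * cnj r'"
    by (metis complex_cnj_mult)
  have eq: "p * r * cnj s = q * r' * cnj s'" using assms(3,4) by (metis add_left_cancel)
  have "cnj s * (p * (r * cnj r)) = (p * r * cnj s) * cnj r" by simp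
  also have "\<dots> = q * r' * (cnj r * cnj s')" by (simp add: eq)
  also have "\<dots> = cnj s * (q * (r' * cnj r'))" by (simp add: par)
  finally have "p * (r * cnj r) = q * (r' * cnj r')" using assms by simp
  then have "complex_of_real (p * (cmod r)\<^sup>2) = complex_of_real (q * (cmod r')\<^sup>2)"
    unfolding of_real_mult complex_norm_square .
  then show ?thesis unfolding of_real_eq_iff .
qed

lemma ray_prod_axis_eq_0_iff: "\<forall>i<3. \<forall>j<3. ray_prod i j = 0 \<longleftrightarrow> i \<noteq> j"
  by (simp add: all_less_3 ray_prod_def sum_less_3 rays_def)

lemma ray_prod_diagonal_eq_0_iff:
  "\<forall>i<3. \<forall>j<3. ray_prod i (3 + j) = 0 \<longleftrightarrow> i = j"
  by (simp add: all_less_3 ray_prod_def sum_less_3 rays_def)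

lemma ray_prod_zeros:
  "ray_prod 3 0 = 0" "ray_prod 6 0 = 0" "ray_prod 4 1 = 0" "ray_prod 7 1 = 0"
  "ray_prod 5 2 = 0" "ray_prod 8 2 = 0"
  "ray_prod 6 3 = 0" "ray_prod 7 4 = 0" "ray_prod 8 5 = 0"
  "ray_prod 6 9 = 0" "ray_prod 7 9 = 0" "ray_prod 8 9 = 0"
  "ray_prod 6 10 = 0" "ray_prod 4 10 = 0" "ray_prod 5 10 = 0"
  "ray_prod 3 11 = 0" "ray_prod 7 11 = 0" "ray_prod 5 11 = 0"
  by (simp_all add: ray_prod_def sum_less_3 rays_def)

lemma ray_prod_nonzeros:
  "ray_prod 3 2 \<noteq> 0" "ray_prod 4 2 \<noteq> 0" "ray_prod 5 0 \<noteq> 0" "ray_prod 5 1 \<noteq> 0"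
  "ray_prod 6 1 \<noteq> 0" "ray_prod 6 2 \<noteq> 0" "ray_prod 7 0 \<noteq> 0" "ray_prod 7 2 \<noteq> 0"
  "ray_prod 8 0 \<noteq> 0" "ray_prod 8 1 \<noteq> 0"
  "ray_prod 9 0 \<noteq> 0" "ray_prod 9 1 \<noteq> 0" "ray_prod 9 2 \<noteq> 0"
  "ray_prod 10 1 \<noteq> 0" "ray_prod 11 0 \<noteq> 0"
  by (simp_all add: ray_prod_def sum_less_3 rays_def)

text \<open>
  The bounds on the numbers of weights include all degenerate forms.  Dependent or isotropic axes
  (rays \<open>0, 1, 2\<close>) therefore have to be ruled out first; this is what \<open>one_nonpos\<close> and
  \<open>not_nonneg\<close> do, using rays \<open>3, 4, 5\<close> to tell the axes apart.
\<close>

lemma no_form_signature_2_1: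
  assumes form: "diagonal_form 12 a K e u"
    and pattern: "\<And>i j. i < 12 \<Longrightarrow> j < 12 \<Longrightarrow> i \<noteq> j \<Longrightarrow> a i j = 0 \<longleftrightarrow> ray_prod i j = 0"
    and pos: "card {k\<in>K. 0 < e k} \<le> 2" and neg: "card {k\<in>K. e k < 0} \<le> 1"
  shows False
proof -
  have herm: "a j i = cnj (a i j)" if "i < 12" "j < 12" for i j
    using form that by (simp add: diagonal_form_def mult_ac)
  define N where "N i = Re (a i i)" for i
  have diag: "a i i = of_real (N i)" if "i < 12" for i
    using herm[OF that that] by (simp add: N_def complex_eq_iff)
  have axis: "a i j = 0" if "i < 3" "j < 3" "i \<noteq> j" for i j
    using pattern[of i j] ray_prod_axis_eq_0_iff that by auto
  have y: "a i (3 + j) = 0 \<longleftrightarrow> i = j" if "i < 3" "j < 3" for i j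
    using pattern[of i "3 + j"] ray_prod_diagonal_eq_0_iff that by auto
  have one_nonpos: False if ij: "i < 3" "j < 3" "i \<noteq> j" and N: "N i \<le> 0" "N j \<le> 0" for i j
  proof -
    have "\<exists>c. (\<exists>l\<in>{i, j}. c l \<noteq> 0) \<and> (\<forall>k<12. (\<Sum>l\<in>{i, j}. c l * a l k) = 0)"
      using ij N axis neg by (intro dependent_rows_nonpos[OF form]) (auto simp: N_def)
    then obtain c where c: "c i \<noteq> 0 \<or> c j \<noteq> 0" "\<And>k. k < 12 \<Longrightarrow> c i * a i k + c j * a j k = 0"
      using ij by auto
    have "c j = 0" using c(2)[of "3 + i"] y[of i i] y[of j i] ij by auto
    moreover have "c i = 0" using c(2)[of "3 + j"] y[of j j] y[of i j] ij by auto
    ultimately show False using c(1) by simp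
  qed
  have not_nonneg: "\<not> (0 \<le> N 0 \<and> 0 \<le> N 1 \<and> 0 \<le> N 2)"
  proof
    assume N: "0 \<le> N 0 \<and> 0 \<le> N 1 \<and> 0 \<le> N 2"
    have "\<exists>c. (\<exists>l\<in>{0, 1, 2}. c l \<noteq> 0) \<and> (\<forall>k<12. (\<Sum>l\<in>{0, 1, 2}. c l * a l k) = 0)"
      using N axis pos by (intro dependent_rows_nonneg[OF form]) (auto simp: N_def)
    then obtain c :: "nat \<Rightarrow> complex" where c: "c 0 \<noteq> 0 \<or> c 1 \<noteq> 0 \<or> c 2 \<noteq> 0"
      "\<And>k. k < 12 \<Longrightarrow> c 0 * a 0 k + c 1 * a 1 k + c 2 * a 2 k = 0"
      by (auto simp: add.assoc)
    have "c 1 = 0 \<longleftrightarrow> c 2 = 0"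
      using c(2)[of "3 + 0"] y[of 0 0] y[of 1 0] y[of 2 0] by auto
    moreover have "c 0 = 0 \<longleftrightarrow> c 2 = 0"
      using c(2)[of "3 + 1"] y[of 0 1] y[of 1 1] y[of 2 1] by auto
    ultimately have "c 0 \<noteq> 0" "c 1 \<noteq> 0" using c(1) by auto
    then have "N 0 = 0" "N 1 = 0"
      using c(2)[of 0] c(2)[of 1] axis[of 1 0] axis[of 2 0] axis[of 0 1] axis[of 2 1] diag by auto
    then show False using one_nonpos[of 0 1] by simp
  qed
  have N_nz: "N i \<noteq> 0" if "i < 3" for i
  proof
    assume "N i = 0"
    moreover have "i = 0 \<or> i = 1 \<or> i = 2" using that by auto
    moreover have "\<not> (N 0 \<le> 0 \<and> N 1 \<le> 0)" "\<not> (N 0 \<le> 0 \<and> N 2 \<le> 0)" "\<not> (N 1 \<le> 0 \<and> N 2 \<le> 0)"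
      using one_nonpos[of 0 1] one_nonpos[of 0 2] one_nonpos[of 1 2] by auto
    ultimately show False using not_nonneg by (elim disjE) auto
  qed
  \<comment> \<open>four vectors in dimension \<open>3\<close> are dependent, so the axes are an orthogonal basis\<close>
  have expand: "a v w = (\<Sum>i<3. a v i * cnj (a w i) / of_real (N i))" if vw: "3 \<le> v" "v < 12" "w < 12" for v w
  proof -
    have fK: "finite K" using form by (simp add: diagonal_form_def)
    have "{k\<in>K. e k \<noteq> 0} = {k\<in>K. 0 < e k} \<union> {k\<in>K. e k < 0}" by auto
    then have "card {k\<in>K. e k \<noteq> 0} \<le> 3"
      using card_Un_le[of "{k\<in>K. 0 < e k}" "{k\<in>K. e k < 0}"] pos neg by simp
    moreover have "card (insert v {..<3}) = 4" using vw by simp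
    ultimately obtain c where c: "\<exists>i\<in>insert v {..<3}. c i \<noteq> 0"
      "\<forall>j<12. (\<Sum>i\<in>insert v {..<3}. c i * a i j) = 0"
      using dependent_rows_rank[OF form, of "insert v {..<3}"] vw by auto
    have row: "c v * a v j + (\<Sum>i<3. c i * a i j) = 0" if "j < 12" for j
      using c(2) that vw by simp
    have col: "c v * a v j + c j * of_real (N j) = 0" if j: "j < 3" for j
    proof -
      have "(\<Sum>i<3. c i * a i j) = (\<Sum>i\<in>{j}. c i * a i j)"
        using j axis by (intro sum.mono_neutral_right) auto
      then show ?thesis using row[of j] diag[of j] j by simp
    qed
    have "c v \<noteq> 0"
    proof
      assume "c v = 0"
      then have "c j = 0" if "j < 3" for j using col[OF that] N_nz[OF that] by simp
      with c(1) \<open>c v = 0\<close> show False by auto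
    qed
    have "c v * a v w = - (\<Sum>i<3. c i * a i w)"
      using row[OF vw(3)] by (simp add: eq_neg_iff_add_eq_0)
    also have "\<dots> = (\<Sum>i<3. c v * (a v i * cnj (a w i) / of_real (N i)))"
      unfolding sum_negf[symmetric]
    proof (intro sum.cong refl)
      fix i :: nat assume "i \<in> {..<3}"
      then have i: "i < 3" by simp
      have "c i = - (c v * a v i) / of_real (N i)"
        using col[OF i] N_nz[OF i] by (simp add: field_simps eq_neg_iff_add_eq_0)
      then show "- (c i * a i w) = c v * (a v i * cnj (a w i) / of_real (N i))"
        using herm[of w i] i vw by simp
    qed
    finally have "c v * a v w = c v * (\<Sum>i<3. a v i * cnj (a w i) / of_real (N i))"
      by (simp only: sum_distrib_left)
    with \<open>c v \<noteq> 0\<close> show ?thesis by simp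
  qed
  define P where "P i = 1 / N i" for i
  have P_nz: "complex_of_real (P i) \<noteq> 0" if "i < 3" for i
    using N_nz[OF that] by (simp add: P_def)
  \<comment> \<open>an orthogonality relation with a vector whose coordinate \<open>k\<close> is zero\<close>
  have orth: "of_real (P i) * a v i * cnj (a w i) + of_real (P j) * a v j * cnj (a w j) = 0"
    if ijk: "{..<3} = {i, j, k}" "i \<noteq> j" "i \<noteq> k" "j \<noteq> k"
      and vw: "3 \<le> v" "v < 12" "w < 12" "v \<noteq> w" "ray_prod v w = 0" "ray_prod v k = 0" for v w i j k
  proof -
    from ijk(1) have "k < 3" by blast
    then have "a v k = 0" using pattern[of v k] vw by simp
    moreover have "a v w = 0" using pattern[of v w] vw by simp
    ultimately show ?thesis
      using expand[OF vw(1-3)] ijk by (simp add: P_def mult_ac)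
  qed
  have nz: "a v i \<noteq> 0" if "v < 12" "i < 12" "v \<noteq> i" "ray_prod v i \<noteq> 0" for v i
    using pattern[of v i] that by simp
  have axes: "{..<3} = {1, 2, 0::nat}" "{..<3} = {0, 2, 1::nat}" "{..<3} = {0, 1, 2::nat}"
      "{..<3} = {1, 0, 2::nat}"
    by auto
  note zero = ray_prod_zeros and nonzero = ray_prod_nonzeros
  \<comment> \<open>ray \<open>10\<close> compares the weights of the coordinates \<open>1\<close> and \<open>2\<close>, and ray \<open>11\<close> those of \<open>0\<close> and \<open>2\<close>\<close>
  have "P 1 * (cmod (a 9 1))\<^sup>2 = P 2 * (cmod (a 9 2))\<^sup>2"
  proof (rule weighted_norms_eq)
    show "of_real (P 1) * a 6 1 * cnj (a 9 1) + of_real (P 2) * a 6 2 * cnj (a 9 2) = 0"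
      by (rule orth[OF axes(1)]) (simp_all add: zero del: One_nat_def)
    show "of_real (P 1) * a 6 1 * cnj (a 10 1) + of_real (P 2) * a 6 2 * cnj (a 10 2) = 0"
      by (rule orth[OF axes(1)]) (simp_all add: zero del: One_nat_def)
    show "of_real (P 0) * a 9 0 * cnj (a 10 0) + of_real (P 1) * a 9 1 * cnj (a 10 1) = 0"
    proof (rule orthogonal_to_partner)
      show "of_real (P 0) * a 8 0 * cnj (a 5 0) + of_real (P 1) * a 8 1 * cnj (a 5 1) = 0"
        by (rule orth[OF axes(3)]) (simp_all add: zero del: One_nat_def)
      show "of_real (P 0) * a 8 0 * cnj (a 9 0) + of_real (P 1) * a 8 1 * cnj (a 9 1) = 0"
        by (rule orth[OF axes(3)]) (simp_all add: zero del: One_nat_def)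
      show "of_real (P 0) * a 5 0 * cnj (a 10 0) + of_real (P 1) * a 5 1 * cnj (a 10 1) = 0"
        by (rule orth[OF axes(3)]) (simp_all add: zero del: One_nat_def)
    qed (simp_all add: P_nz nz nonzero del: of_real_eq_0_iff One_nat_def)
    show "of_real (P 0) * a 9 0 * cnj (a 10 0) + of_real (P 2) * a 9 2 * cnj (a 10 2) = 0"
    proof (rule orthogonal_to_partner)
      show "of_real (P 0) * a 7 0 * cnj (a 4 0) + of_real (P 2) * a 7 2 * cnj (a 4 2) = 0"
        by (rule orth[OF axes(2)]) (simp_all add: zero del: One_nat_def)
      show "of_real (P 0) * a 7 0 * cnj (a 9 0) + of_real (P 2) * a 7 2 * cnj (a 9 2) = 0"
        by (rule orth[OF axes(2)]) (simp_all add: zero del: One_nat_def)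
      show "of_real (P 0) * a 4 0 * cnj (a 10 0) + of_real (P 2) * a 4 2 * cnj (a 10 2) = 0"
        by (rule orth[OF axes(2)]) (simp_all add: zero del: One_nat_def)
    qed (simp_all add: P_nz nz nonzero del: of_real_eq_0_iff One_nat_def)
  qed (use N_nz in \<open>simp_all add: P_def nz nonzero del: One_nat_def\<close>)
  moreover have "P 0 * (cmod (a 9 0))\<^sup>2 = P 2 * (cmod (a 9 2))\<^sup>2"
  proof (rule weighted_norms_eq)
    show "of_real (P 0) * a 7 0 * cnj (a 9 0) + of_real (P 2) * a 7 2 * cnj (a 9 2) = 0"
      by (rule orth[OF axes(2)]) (simp_all add: zero del: One_nat_def)
    show "of_real (P 0) * a 7 0 * cnj (a 11 0) + of_real (P 2) * a 7 2 * cnj (a 11 2) = 0"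
      by (rule orth[OF axes(2)]) (simp_all add: zero del: One_nat_def)
    show "of_real (P 1) * a 9 1 * cnj (a 11 1) + of_real (P 0) * a 9 0 * cnj (a 11 0) = 0"
    proof (rule orthogonal_to_partner)
      show "of_real (P 1) * a 8 1 * cnj (a 5 1) + of_real (P 0) * a 8 0 * cnj (a 5 0) = 0"
        by (rule orth[OF axes(4)]) (simp_all add: zero del: One_nat_def)
      show "of_real (P 1) * a 8 1 * cnj (a 9 1) + of_real (P 0) * a 8 0 * cnj (a 9 0) = 0"
        by (rule orth[OF axes(4)]) (simp_all add: zero del: One_nat_def)
      show "of_real (P 1) * a 5 1 * cnj (a 11 1) + of_real (P 0) * a 5 0 * cnj (a 11 0) = 0"
        by (rule orth[OF axes(4)]) (simp_all add: zero del: One_nat_def)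
    qed (simp_all add: P_nz nz nonzero del: of_real_eq_0_iff One_nat_def)
    show "of_real (P 1) * a 9 1 * cnj (a 11 1) + of_real (P 2) * a 9 2 * cnj (a 11 2) = 0"
    proof (rule orthogonal_to_partner)
      show "of_real (P 1) * a 6 1 * cnj (a 3 1) + of_real (P 2) * a 6 2 * cnj (a 3 2) = 0"
        by (rule orth[OF axes(1)]) (simp_all add: zero del: One_nat_def)
      show "of_real (P 1) * a 6 1 * cnj (a 9 1) + of_real (P 2) * a 6 2 * cnj (a 9 2) = 0"
        by (rule orth[OF axes(1)]) (simp_all add: zero del: One_nat_def)
      show "of_real (P 1) * a 3 1 * cnj (a 11 1) + of_real (P 2) * a 3 2 * cnj (a 11 2) = 0"
        by (rule orth[OF axes(1)]) (simp_all add: zero del: One_nat_def)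
    qed (simp_all add: P_nz nz nonzero del: of_real_eq_0_iff One_nat_def)
  qed (use N_nz in \<open>simp_all add: P_def nz nonzero del: One_nat_def\<close>)
  moreover have "a 9 0 \<noteq> 0" "a 9 1 \<noteq> 0" "a 9 2 \<noteq> 0"
    by (simp_all add: nz nonzero del: One_nat_def)
  then have "0 < (cmod (a 9 0))\<^sup>2" "0 < (cmod (a 9 1))\<^sup>2" "0 < (cmod (a 9 2))\<^sup>2"
    by simp_all
  ultimately have "(0 < P 1 \<longleftrightarrow> 0 < P 2) \<and> (0 < P 0 \<longleftrightarrow> 0 < P 2)"
    by (metis zero_less_mult_iff less_asym)
  then have "(0 < N 1 \<longleftrightarrow> 0 < N 2) \<and> (0 < N 0 \<longleftrightarrow> 0 < N 2)"
    by (simp add: P_def)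
  then show False
    using not_nonneg one_nonpos[of 0 1] by force
qed

lemma herm_inertia_set_G12_excluded:
  assumes "(r, s) \<in> herm_inertia_set G12"
  shows "\<not> (r \<le> 2 \<and> s \<le> 1)" and "\<not> (r \<le> 1 \<and> s \<le> 2)"
proof -
  from assms obtain A where A: "A \<in> herm_mats G12"
    and rs: "r = num_pos_eigenvalues A" "s = num_neg_eigenvalues A"
    by (auto simp: herm_inertia_set_def pin_def)
  from A have carrier: "A \<in> carrier_mat 12 12" and adj: "mat_adjoint A = A"
    by (auto simp: herm_mats_def has_pattern_def G12_def)
  from A have pattern: "A $$ (i, j) = 0 \<longleftrightarrow> ray_prod i j = 0" if "i < 12" "j < 12" "i \<noteq> j" for i j
    using that by (auto simp: herm_mats_def has_pattern_def G12_def)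
  obtain e u where form: "diagonal_form 12 (\<lambda>i j. A $$ (i, j)) {..<12::nat} e u"
    and pos: "num_pos_eigenvalues A = card {k\<in>{..<12::nat}. 0 < e k}"
    and neg: "num_neg_eigenvalues A = card {k\<in>{..<12::nat}. e k < 0}"
    by (rule hermitian_diagonal_form[OF carrier adj]) (rule that)
  show "\<not> (r \<le> 2 \<and> s \<le> 1)"
    using no_form_signature_2_1[OF form pattern] by (auto simp: rs pos neg)
  show "\<not> (r \<le> 1 \<and> s \<le> 2)"
    using no_form_signature_2_1[OF diagonal_form_uminus[OF form]] pattern
    by (auto simp: rs pos neg)
qed

section \<open>Matrices with few positive and negative terms\<close>

lemma inertia_set_subset_herm_inertia_set:
  assumes "pverts G = {0..<n}"
  shows "inertia_set G \<subseteq> herm_inertia_set G"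
proof -
  have "map_mat complex_of_real A \<in> herm_mats G" if "A \<in> sym_mats G" for A
  proof -
    from that have A: "A \<in> carrier_mat n n" and sym: "transpose_mat A = A"
      using assms by (auto simp: sym_mats_def has_pattern_def)
    have "A $$ (j, i) = A $$ (i, j)" if "i < n" "j < n" for i j
      using arg_cong[OF sym, of "\<lambda>X. X $$ (i, j)"] A that by simp
    then have "mat_adjoint (map_mat complex_of_real A) = map_mat complex_of_real A"
      using A mat_adjoint_index[of "map_mat complex_of_real A" n]
      by (intro eq_matI) (auto simp: mat_adjoint_def)
    moreover have "has_pattern G (map_mat complex_of_real A)"
      using that A assms by (auto simp: sym_mats_def has_pattern_def)
    ultimately show ?thesis by (simp add: herm_mats_def)
  qed
  then show ?thesis by (auto simp: inertia_set_def herm_inertia_set_def)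
qed

text \<open>
  Integer data keep the pattern condition decidable by simplification.  The last conclusion is
  about diagonal entries: a negative one is witness to a negative eigenvalue.
\<close>

lemma inertia_set_G12_realize:
  fixes e :: "nat \<Rightarrow> int" and w :: "nat \<Rightarrow> nat \<Rightarrow> int"
  assumes pattern: "\<forall>i<12. \<forall>j<12. i \<noteq> j \<longrightarrow>
      ((\<Sum>k<m. e k * w k i * w k j) = 0 \<longleftrightarrow> ray_prod i j = 0)"
  obtains p q where "(p, q) \<in> inertia_set G12"
    and "p \<le> card {k\<in>{..<m}. 0 < e k}" and "q \<le> card {k\<in>{..<m}. e k < 0}"
    and "\<And>i. i < 12 \<Longrightarrow> (\<Sum>k<m. e k * w k i * w k i) < 0 \<Longrightarrow> 0 < q"
proof -
  define a where "a i j = (\<Sum>k<m. e k * w k i * w k j)" for i j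
  define A where "A = mat 12 12 (\<lambda>(i, j). real_of_int (a i j))"
  define C where "C = map_mat complex_of_real A"
  have a_commute: "a i j = a j i" for i j by (simp add: a_def mult_ac)
  have sym: "A \<in> sym_mats G12"
    unfolding sym_mats_def has_pattern_def
    using pattern by (auto simp: A_def G12_def a_commute simp flip: a_def intro!: eq_matI)
  then have mem: "pin C \<in> inertia_set G12" by (auto simp: inertia_set_def C_def)
  have C: "C \<in> carrier_mat 12 12" by (simp add: C_def A_def)
  have Cij: "C $$ (i, j) = of_int (a i j)" if "i < 12" "j < 12" for i j
    using that by (simp add: C_def A_def)
  have adj: "mat_adjoint C = C"
    using C by (intro eq_matI) (auto simp: mat_adjoint_index[OF C] Cij a_commute, auto simp: mat_adjoint_def)
  have form: "diagonal_form 12 (\<lambda>i j. C $$ (i, j)) {..<m} (\<lambda>k. real_of_int (e k)) (\<lambda>k i. of_int (w k i))"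
    by (simp add: diagonal_form_def Cij a_def)
  show ?thesis
  proof (rule that)
    show "(num_pos_eigenvalues C, num_neg_eigenvalues C) \<in> inertia_set G12"
      using mem by (simp add: pin_def)
    show "num_pos_eigenvalues C \<le> card {k\<in>{..<m}. 0 < e k}"
      and "num_neg_eigenvalues C \<le> card {k\<in>{..<m}. e k < 0}"
      using num_eigenvalues_le[OF C adj form] by simp_all
    show "0 < num_neg_eigenvalues C" if "i < 12" "(\<Sum>k<m. e k * w k i * w k i) < 0" for i
      using num_neg_eigenvalues_pos[OF C adj that(1)] that
      by (simp add: Cij a_def flip: of_int_mult of_int_sum)
  qed
qed

lemma G12_3_0: "(3, 0) \<in> inertia_set G12"
proof -
  obtain p q where pq: "(p, q) \<in> inertia_set G12"
    "p \<le> card {k\<in>{..<3::nat}. 0 < (1::int)}" "q \<le> card {k\<in>{..<3::nat}. (1::int) < 0}"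
    by (rule inertia_set_G12_realize[where m = 3 and e = "\<lambda>_. 1" and w = "\<lambda>k i. rays ! i ! k"])
      (simp add: ray_prod_def, rule that)
  moreover have "(p, q) \<in> herm_inertia_set G12"
    using pq(1) inertia_set_subset_herm_inertia_set[of G12 12] by (auto simp: G12_def)
  ultimately show ?thesis
    using herm_inertia_set_G12_excluded[of p q] by (cases "p = 3") auto
qed

text \<open>
  Subtracting \<open>2\<close> from one diagonal entry of the Gram matrix keeps the pattern and adds a single
  negative term.  The Gram matrix has the entry \<open>1\<close> there, so the new entry is negative, which
  excludes \<open>(3, 0)\<close>.
\<close>

lemma G12_3_1: "(3, 1) \<in> inertia_set G12"
proof -
  define e :: "nat \<Rightarrow> int" where "e k = (if k < 3 then 1 else - 2)" for k
  define w :: "nat \<Rightarrow> nat \<Rightarrow> int" where "w k i = (if k < 3 then rays ! i ! k else of_bool (i = 0))" for k i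
  have gram: "(\<Sum>k<4. e k * w k i * w k j) = ray_prod i j - 2 * of_bool (i = 0) * of_bool (j = 0)" for i j
  proof -
    have "{..<4} = insert 3 {..<3::nat}" by auto
    then show ?thesis by (simp add: e_def w_def ray_prod_def)
  qed
  have "{k\<in>{..<4}. 0 < e k} = {..<3}" "{k\<in>{..<4}. e k < 0} = {3}"
    by (auto simp: e_def split: if_splits)
  then have cards: "card {k\<in>{..<4}. 0 < e k} = 3" "card {k\<in>{..<4}. e k < 0} = 1"
    by simp_all
  have "\<forall>i<12. \<forall>j<12. i \<noteq> j \<longrightarrow> ((\<Sum>k<4. e k * w k i * w k j) = 0 \<longleftrightarrow> ray_prod i j = 0)"
    by (auto simp: gram)
  then obtain p q where pq: "(p, q) \<in> inertia_set G12"
    "p \<le> card {k\<in>{..<4}. 0 < e k}" "q \<le> card {k\<in>{..<4}. e k < 0}"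
    "\<And>i. i < 12 \<Longrightarrow> (\<Sum>k<4. e k * w k i * w k i) < 0 \<Longrightarrow> 0 < q"
    using inertia_set_G12_realize by blast
  have "ray_prod 0 0 = 1" by (simp add: ray_prod_def sum_less_3 rays_def)
  then have "0 < q" using pq(4)[of 0] by (simp add: gram)
  moreover have "(p, q) \<in> herm_inertia_set G12"
    using pq(1) inertia_set_subset_herm_inertia_set[of G12 12] by (auto simp: G12_def)
  ultimately show ?thesis
    using pq(1-3) herm_inertia_set_G12_excluded[of p q] unfolding cards
    by (cases "p = 3"; cases "q = 1") auto
qed

text \<open>
  Twelve vectors with the orthogonality relations of \<open>rays\<close> for the form of signature \<open>(2, 2)\<close> with
  weights \<open>1, 1, -1, -1\<close>.  In dimension \<open>4\<close> the relations leave room: each of the last three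
  vectors only has to be orthogonal to three of the first nine, which always has a solution.
\<close>

definition neutral_vectors :: "int list list" where
  "neutral_vectors = [[1, 0, 0, 0], [0, 1, 0, 0], [0, 0, 1, 0],
     [0, 1, -1, 1], [1, 0, -1, 1], [1, 1, 0, 0],
     [0, 1, 1, 2], [1, 0, 1, 2], [1, -1, 0, 2],
     [1, 1, 1, 0], [-1, 1, 1, 0], [1, -1, 1, 0]]"

lemma G12_2_2: "(2, 2) \<in> inertia_set G12"
proof -
  define e :: "nat \<Rightarrow> int" where "e k = (if k < 2 then 1 else - 1)" for k
  have "{k\<in>{..<4}. 0 < e k} = {..<2}" "{k\<in>{..<4}. e k < 0} = {2, 3}"
    by (auto simp: e_def split: if_splits)
  then have cards: "card {k\<in>{..<4}. 0 < e k} = 2" "card {k\<in>{..<4}. e k < 0} = 2"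
    by simp_all
  have "\<forall>i<12. \<forall>j<12. i \<noteq> j \<longrightarrow>
      ((\<Sum>k<4. (if k < 2 then 1 else - 1) * neutral_vectors ! i ! k * neutral_vectors ! j ! k) = 0
        \<longleftrightarrow> ray_prod i j = 0)"
    by (simp add: all_less_12 sum_less_4 ray_prod_def sum_less_3 rays_def neutral_vectors_def)
  then have "\<forall>i<12. \<forall>j<12. i \<noteq> j \<longrightarrow>
      ((\<Sum>k<4. e k * neutral_vectors ! i ! k * neutral_vectors ! j ! k) = 0 \<longleftrightarrow> ray_prod i j = 0)"
    unfolding e_def .
  then obtain p q where pq: "(p, q) \<in> inertia_set G12"
    "p \<le> card {k\<in>{..<4}. 0 < e k}" "q \<le> card {k\<in>{..<4}. e k < 0}"
    using inertia_set_G12_realize[where m = 4 and e = e and w = "\<lambda>k i. neutral_vectors ! i ! k"] by blast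
  moreover have "(p, q) \<in> herm_inertia_set G12"
    using pq(1) inertia_set_subset_herm_inertia_set[of G12 12] by (auto simp: G12_def)
  ultimately show ?thesis
    using herm_inertia_set_G12_excluded[of p q] unfolding cards
    by (cases "p = 2"; cases "q = 2") auto
qed

theorem theorem7p3:
  shows "\<exists>G :: nat pair_pre_digraph. pair_graph G \<and> pverts G = {0..<12} \<and>
           inertial_partition G = [3, 3, 2] \<and> herm_inertial_partition G = [3, 3, 2]"
proof (intro exI conjI)
  show "pair_graph G12" by (rule pair_graph_G12)
  show verts: "pverts G12 = {0..<12}" by (simp add: G12_def)
  have sub: "inertia_set G12 \<subseteq> herm_inertia_set G12"
    by (rule inertia_set_subset_herm_inertia_set[OF verts])
  have least: "(LEAST r. (r, 0) \<in> I) = 3" "(LEAST r. (r, 1) \<in> I) = 3" "(LEAST r. (r, 2) \<in> I) = 2"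
    if I: "inertia_set G12 \<subseteq> I" "I \<subseteq> herm_inertia_set G12" for I
  proof -
    have lower: "3 \<le> r" if "(r, s) \<in> I" "s \<le> 1" for r s
      using herm_inertia_set_G12_excluded(1)[of r s] I that by auto
    have lower2: "2 \<le> r" if "(r, 2) \<in> I" for r
      using herm_inertia_set_G12_excluded(2)[of r 2] I that by auto
    show "(LEAST r. (r, 0) \<in> I) = 3"
      using G12_3_0 I lower by (intro Least_equality) auto
    show "(LEAST r. (r, 1) \<in> I) = 3"
      using G12_3_1 I lower by (intro Least_equality) auto
    show "(LEAST r. (r, 2) \<in> I) = 2"
      using G12_2_2 I lower2 by (intro Least_equality) auto
  qed
  have list: "[0..<3] = [0, 1, 2::nat]" by (simp add: upt_rec)
  show "inertial_partition G12 = [3, 3, 2]"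
    using least[OF order_refl sub] by (simp add: inertial_partition_def min_pos_def list)
  show "herm_inertial_partition G12 = [3, 3, 2]"
    using least[OF sub order_refl] by (simp add: herm_inertial_partition_def herm_min_pos_def list)
qed

end
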